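(* Let $N, M$ be positive integers, let $\alpha,\beta\in(0,1)$, let $P>0$, and let $f:\mathbb{R}\to\mathbb{R}$ be a non-linear $P$-periodic function. Let $X(N,f,\beta,\alpha)$ be the reservoir of length $N$ with nonlinearity $f$, input gain $\beta$ and feedback gain $\alpha$, and let $u,v\in\mathbb{R}^M$ be inputs. If $v(t)=u(t)-\frac{P}{\beta}$ for all $t\in\{1,\dots,M\}$, then $x^{(u)}(t)=x^{(v)}(t)$ for all $t\in\{0,1,\dots,M\}$.
   Context: Time $t$ is discrete, $t\in\mathbb{Z}_{\ge 0}$. An input is a vector $u=(u(1),\dots,u(M))\in\mathbb{R}^M$, with the convention $u(0)=0$; reservoirs are considered over the time interval $\{1,\dots,M\}$. The reservoir $X(N,f,\beta,\alpha)$ driven by the input $u$ has node states $x_1^{(u)},\dots,x_N^{(u)}$ determined by $$x_k^{(u)}(0)=0\quad (1\le k\le N),$$ $$x_1^{(u)}(t)=f\big(\alpha x_N^{(u)}(t-1)+\beta u(t)\big)\quad (t\ge 1),$$ $$x_{k+1}^{(u)}(t)=x_k^{(u)}(t-1)\quad (1\le k\le N-1,\ t\ge 1).$$ The state of the reservoir at time $t$ with input $u$ is the tuple $x^{(u)}(t)=(x_1^{(u)}(t),\dots,x_N^{(u)}(t))$. A function $f$ is $P$-periodic if $f(s+P)=f(s)$ for all $s\in\mathbb{R}$. *)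

theory Defs
  imports Complex_Main "HOL-Library.Periodic_Fun"
begin

(* R^M with coordinates numbered 1..M.  Vanishing off {1..M} makes the representation unique
   and includes the convention u 0 = 0. *)
definition inputs :: "nat \<Rightarrow> (nat \<Rightarrow> real) set" where
  "inputs M = {u. \<forall>t. t \<notin> {1..M} \<longrightarrow> u t = 0}"

(* reservoir_node N f \<beta> \<alpha> u t k is the state of node k at time t; only nodes 1..N are meaningful. *)
primrec reservoir_node ::
  "nat \<Rightarrow> (real \<Rightarrow> real) \<Rightarrow> real \<Rightarrow> real \<Rightarrow> (nat \<Rightarrow> real) \<Rightarrow> nat \<Rightarrow> nat \<Rightarrow> real" where
  "reservoir_node N f \<beta> \<alpha> u 0 = (\<lambda>k. 0)"
| "reservoir_node N f \<beta> \<alpha> u (Suc t) =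
     (\<lambda>k. if k = 1 then f (\<alpha> * reservoir_node N f \<beta> \<alpha> u t N + \<beta> * u (Suc t))
          else reservoir_node N f \<beta> \<alpha> u t (k - 1))"

definition reservoir_state ::
  "nat \<Rightarrow> (real \<Rightarrow> real) \<Rightarrow> real \<Rightarrow> real \<Rightarrow> (nat \<Rightarrow> real) \<Rightarrow> nat \<Rightarrow> real list" where
  "reservoir_state N f \<beta> \<alpha> u t = map (reservoir_node N f \<beta> \<alpha> u t) [1..<Suc N]"

lemma reservoir_node_first:
  "t \<ge> 1 \<Longrightarrow> reservoir_node N f \<beta> \<alpha> u t 1 =
     f (\<alpha> * reservoir_node N f \<beta> \<alpha> u (t - 1) N + \<beta> * u t)"
  by (cases t) auto

lemma reservoir_node_shift:
  "t \<ge> 1 \<Longrightarrow> 1 \<le> k \<Longrightarrow> k \<le> N - 1 \<Longrightarrow>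
     reservoir_node N f \<beta> \<alpha> u t (k + 1) = reservoir_node N f \<beta> \<alpha> u (t - 1) k"
  by (cases t) auto

end

theory Submission
  imports Defs
begin

text \<open>
  The input enters the dynamics only through \<open>\<beta> * u t\<close>, inside the argument of \<open>f\<close>. Lowering
  \<open>u t\<close> by \<open>P / \<beta>\<close> lowers that argument by exactly one period \<open>P\<close>, which \<open>f\<close> does not see; so the
  first node receives the same value at every step, and by induction on time no node ever tells
  the two inputs apart.
\<close>

text \<open>
  Only the inputs up to time \<open>t\<close> influence the states at time \<open>t\<close>, so agreement up to a period is
  asked for at those times alone. The node functions are compared on all indices at once, because
  the step for node \<open>k\<close> refers to the previous states of nodes \<open>N\<close> and \<open>k - 1\<close>.
\<close>

lemma reservoir_node_shift_input:
  assumes "periodic_fun_simple f P" and "\<beta> \<noteq> 0"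
    and "\<forall>s\<in>{1..t}. v s = u s - P / \<beta>"
  shows "reservoir_node N f \<beta> \<alpha> v t = reservoir_node N f \<beta> \<alpha> u t"
  using assms(3)
proof (induction t)
  case 0
  show ?case by simp
next
  case (Suc t)
  interpret periodic_fun_simple f P by (fact assms(1))
  have IH: "reservoir_node N f \<beta> \<alpha> v t = reservoir_node N f \<beta> \<alpha> u t"
    using Suc by simp
  have "\<beta> * v (Suc t) = \<beta> * u (Suc t) - P"
    using Suc.prems \<open>\<beta> \<noteq> 0\<close> by (simp add: right_diff_distrib)
  then have "f (c + \<beta> * v (Suc t)) = f (c + \<beta> * u (Suc t))" for c
    using minus_1[of "c + \<beta> * u (Suc t)"] by (simp add: add_diff_eq)
  then show ?case
    by (simp add: IH fun_eq_iff)
qed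

theorem fact4p5:
  fixes N M :: nat and \<alpha> \<beta> P :: real and f :: "real \<Rightarrow> real" and u v :: "nat \<Rightarrow> real"
  assumes "N > 0" and "M > 0"
    and "\<alpha> \<in> {0<..<1}" and "\<beta> \<in> {0<..<1}"
    and "P > 0"
    and "\<not> linear f"
    and "periodic_fun_simple f P"
    and "u \<in> inputs M" and "v \<in> inputs M"
    and "\<forall>t\<in>{1..M}. v t = u t - P / \<beta>"
  shows "\<forall>t\<in>{0..M}. reservoir_state N f \<beta> \<alpha> u t = reservoir_state N f \<beta> \<alpha> v t"
proof
  fix t assume "t \<in> {0..M}"
  then have "reservoir_node N f \<beta> \<alpha> v t = reservoir_node N f \<beta> \<alpha> u t"
    using assms by (intro reservoir_node_shift_input[where P = P]) auto
  then show "reservoir_state N f \<beta> \<alpha> u t = reservoir_state N f \<beta> \<alpha> v t"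
    by (simp add: reservoir_state_def)
qed

end
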